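(* There exists a sequence of functions $G=(g_1,g_2,\dots)$ with $g_i\in F_i$ for every $i\ge1$ such that for every positive integer $m$, $|E(Tree_m^G)|<(2m)^c$, where $c=1.984\ldots$ is the unique positive solution of $$\frac{1}{2^c}+\frac{1}{2^{2c}}+\frac{1}{2^{c-1}-1}-\frac{1}{2^c-1}=1.$$
   Context: For a positive integer $p$, $F_p$ is the set of functions $f:\{1,\dots,p\}\to\{0,1,\dots,\lfloor p/2\rfloor\}$ such that for every $n\in\{1,\dots,p\}$ and every integer $1\le i\le\lfloor n/2\rfloor$ there exists an integer $k$ with $n-i+1\le k\le n$ and $f(k)\ge i$. A rooted tree is a tree with a distinguished vertex, the root. For rooted trees $T_1,\dots,T_k$ (possibly empty, taken as disjoint copies), $[T_1,\dots,T_k]$ is the rooted tree obtained from a path $v_1v_2\cdots v_{k+1}$ (with $k$ edges) by adding, for each $j$ with $T_j$ nonempty, the tree $T_j$ and the edge $\{v_j,r(T_j)\}$ where $r(T_j)$ is the root of $T_j$; its root is $v_1$. For a sequence $G=(g_1,g_2,\dots)$ with $g_i\in F_i$, define rooted trees $T_n$ for $n\ge-1$ by: $T_{-1}=\emptyset$ (empty tree), $T_0$ a single vertex, and for $n\ge1$, $T_n=[T_{\min(g_n(n)-1,\,n-1)},\,T_{\min(g_n(n-1)-1,\,n-1)},\,\dots,\,T_{\min(g_n(1)-1,\,n-1)}]$ (the $j$-th entry is $T_{\min(g_n(n+1-j)-1,\,n-1)}$). Then $Tree_m^G:=T_m$, and $|E(\cdot)|$ denotes the number of edges. *)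

theory Defs
  imports Complex_Main "HOL-Library.FuncSet"
begin

definition F_funs :: "nat \<Rightarrow> (nat \<Rightarrow> nat) set" where
  "F_funs p = {f \<in> {1..p} \<rightarrow>\<^sub>E {0..p div 2}.
            \<forall>n\<in>{1..p}. \<forall>i\<in>{1..n div 2}. \<exists>k\<in>{n - i + 1..n}. f k \<ge> i}"

text \<open>
  The vertex names make the copies of trees in the construction below disjoint:
  \<open>Spine j\<close> is the vertex $v_j$ of the path, and \<open>Branch j x\<close> is the vertex \<open>x\<close> in the
  copy of the tree attached to $v_j$.
\<close>

datatype vertex = Spine nat | Branch nat vertex

text \<open>Undirected graphs with a distinguished vertex; an edge is the set of its two end points.\<close>

record rooted_graph =
  verts :: "vertex set"
  edges :: "vertex set set"
  root :: vertex

text \<open>A possibly empty rooted tree is an option; \<open>None\<close> is the empty tree.\<close>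

definition single_vertex :: rooted_graph where
  "single_vertex = \<lparr>verts = {Spine 1}, edges = {}, root = Spine 1\<rparr>"

definition bracket :: "rooted_graph option list \<Rightarrow> rooted_graph" where
  "bracket Ts = (let k = length Ts in
    \<lparr>verts = Spine ` {1..k + 1} \<union>
       (\<Union>j\<in>{1..k}. case Ts ! (j - 1) of
          None \<Rightarrow> {}
        | Some T \<Rightarrow> Branch j ` verts T),
     edges = {{Spine j, Spine (j + 1)} | j. j \<in> {1..k}} \<union>
       (\<Union>j\<in>{1..k}. case Ts ! (j - 1) of
          None \<Rightarrow> {}
        | Some T \<Rightarrow> insert {Spine j, Branch j (root T)} ((\<lambda>e. Branch j ` e) ` edges T)),
     root = Spine 1\<rparr>)"

text \<open>Only the indices $n \ge -1$ matter; smaller ones are sent to the empty tree.\<close>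

function Tree :: "(nat \<Rightarrow> nat \<Rightarrow> nat) \<Rightarrow> int \<Rightarrow> rooted_graph option" where
  "Tree G n =
     (if n \<le> -1 then None
      else if n = 0 then Some single_vertex
      else Some (bracket
        (map (\<lambda>j. Tree G (min (int (G (nat n) (nat (n + 1 - j))) - 1) (n - 1))) [1..n])))"
  by pat_completeness auto
termination
  by (relation "measure (\<lambda>(G, n). nat (n + 1))") auto

declare Tree.simps [simp del]

definition num_edges :: "rooted_graph option \<Rightarrow> nat" where
  "num_edges t = (case t of None \<Rightarrow> 0 | Some T \<Rightarrow> card (edges T))"

text \<open>
  At $c = 1$ the left-hand side is really undefined; with \<open>1 / 0 = 0\<close> it becomes $-1/4$, so no
  spurious solution arises there.
\<close>

definition exponent_equation :: "real \<Rightarrow> bool" where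
  "exponent_equation c \<longleftrightarrow>
     1 / 2 powr c + 1 / 2 powr (2 * c) + 1 / (2 powr (c - 1) - 1) - 1 / (2 powr c - 1) = 1"

end

theory Submission
  imports Defs "HOL-Computational_Algebra.Primes"
begin

text \<open>
  Let $2^v$ be the largest power of two dividing $k$, put
  $h(k) = \min(2^{v+1} - 1, \lfloor (3k-1)/4 \rfloor)$ and take $g_n(k) = \min(h(k), \lfloor n/2 \rfloor)$.
  The second bound in $h$ only matters at powers of two, where it lowers $2k - 1$ to about $3k/4$.
  Let $A(g)$ be the number of vertices of $T_{g-1}$ and $u_L = A(2^L - 1)$. A spine of length
  $2^L - 2$ carries $2^{L-j} - 1$ or fewer trees of size $u_j$ for each $j < L$, and the
  powers of two $2^v$ on it contribute $A(h(2^v)) \le u_v - u_{v-1}$ each, which telescopes. Hence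
  $u_L < 2^L + u_{L-1} + \sum_{j<L} (2^{L-j} - 1) u_j$, and induction gives
  $u_L \le \frac{1}{2} y^L$ with $y = 3.9 < 2^c$. Comparing $m + 1$ with the next power of two
  yields the bound for every $m$.
\<close>

subsection \<open>Counting edges\<close>

text \<open>The empty set is excluded because every \<open>Branch j\<close> maps it to itself, so it
  could belong to two branches at once.\<close>

definition wf_edges :: "rooted_graph option \<Rightarrow> bool" where
  "wf_edges t \<longleftrightarrow> (case t of None \<Rightarrow> True | Some T \<Rightarrow> finite (edges T) \<and> {} \<notin> edges T)"

text \<open>Counting vertices as edges plus one avoids proving that the graphs are trees. The extra
  one also accounts for the edge joining a branch to the spine.\<close>

definition num_verts :: "rooted_graph option \<Rightarrow> nat" where
  "num_verts t = (case t of None \<Rightarrow> 0 | Some T \<Rightarrow> Suc (card (edges T)))"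

definition branch_edges :: "nat \<Rightarrow> rooted_graph option \<Rightarrow> vertex set set" where
  "branch_edges j t = (case t of None \<Rightarrow> {}
     | Some T \<Rightarrow> insert {Spine j, Branch j (root T)} ((\<lambda>e. Branch j ` e) ` edges T))"

text \<open>The last two facts keep the branches apart from the spine and from each other, so that
  cardinalities add up.\<close>

lemma branch_edges_props:
  assumes "wf_edges t"
  shows "finite (branch_edges j t)" "card (branch_edges j t) = num_verts t"
    "e \<in> branch_edges j t \<Longrightarrow> \<exists>x. Branch j x \<in> e"
    "e \<in> branch_edges j t \<Longrightarrow> Branch i x \<in> e \<Longrightarrow> i = j"
proof -
  have inj: "inj (\<lambda>e. Branch j ` e)" for j
    by (rule injI) (simp add: inj_image_eq_iff inj_def)
  have notin: "{Spine j, Branch j r} \<notin> (\<lambda>e. Branch j ` e) ` E" for r E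
    by blast
  show "finite (branch_edges j t)"
    using assms by (auto simp: branch_edges_def wf_edges_def split: option.splits)
  show "card (branch_edges j t) = num_verts t"
    using assms notin card_image[OF inj_on_subset[OF inj subset_UNIV]]
    by (auto simp: branch_edges_def wf_edges_def num_verts_def split: option.splits)
  show "\<exists>x. Branch j x \<in> e" if "e \<in> branch_edges j t"
  proof (cases t)
    case (Some T)
    with that consider "e = {Spine j, Branch j (root T)}" | e' where "e' \<in> edges T" "e = Branch j ` e'"
      by (auto simp: branch_edges_def)
    then show ?thesis
    proof cases
      case 2
      then have "e' \<noteq> {}" using assms Some by (auto simp: wf_edges_def)
      with 2 show ?thesis by auto
    qed auto
  qed (use that in \<open>simp add: branch_edges_def\<close>)
  show "i = j" if "e \<in> branch_edges j t" "Branch i x \<in> e"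
    using that by (auto simp: branch_edges_def split: option.splits)
qed

lemma edges_bracket:
  "edges (bracket Ts) = (\<lambda>j. {Spine j, Spine (j + 1)}) ` {1..length Ts} \<union>
     (\<Union>j\<in>{1..length Ts}. branch_edges j (Ts ! (j - 1)))"
  by (auto simp: bracket_def Let_def branch_edges_def)

lemma bracket_edges:
  assumes "\<And>t. t \<in> set Ts \<Longrightarrow> wf_edges t"
  shows "wf_edges (Some (bracket Ts))"
    and "card (edges (bracket Ts)) = length Ts + (\<Sum>j\<in>{1..length Ts}. num_verts (Ts ! (j - 1)))"
proof -
  let ?I = "{1..length Ts}" and ?S = "\<lambda>j. {Spine j, Spine (j + 1)}"
    and ?B = "\<lambda>j. branch_edges j (Ts ! (j - 1))"
  have wf: "wf_edges (Ts ! (j - 1))" if "j \<in> ?I" for j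
    using that by (intro assms nth_mem) auto
  note B = branch_edges_props[OF wf]
  have inj: "inj_on ?S ?I"
    by (rule inj_onI) (auto simp: doubleton_eq_iff)
  have disj: "?S ` ?I \<inter> (\<Union>j\<in>?I. ?B j) = {}"
    using B(3) by fastforce
  have cardB: "card (\<Union>j\<in>?I. ?B j) = (\<Sum>j\<in>?I. num_verts (Ts ! (j - 1)))"
  proof (subst card_UN_disjoint)
    show "\<forall>i\<in>?I. \<forall>j\<in>?I. i \<noteq> j \<longrightarrow> ?B i \<inter> ?B j = {}"
      using B(3,4) by (metis disjoint_iff)
  qed (use B in auto)
  show "card (edges (bracket Ts)) = length Ts + (\<Sum>j\<in>?I. num_verts (Ts ! (j - 1)))"
  proof -
    have "card (edges (bracket Ts)) = card (?S ` ?I) + card (\<Union>j\<in>?I. ?B j)"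
      unfolding edges_bracket by (rule card_Un_disjoint) (use disj B(1) in simp_all)
    then show ?thesis
      by (simp only: card_image[OF inj] cardB card_atLeastAtMost diff_Suc_1)
  qed
  show "wf_edges (Some (bracket Ts))"
    using B(1,3) by (fastforce simp: wf_edges_def edges_bracket)
qed

lemma wf_edges_Tree: "wf_edges (Tree G n)"
proof (induction G n rule: Tree.induct)
  case (1 G n)
  show ?case
  proof (cases "n \<le> 0")
    case True
    then show ?thesis
      by (subst Tree.simps) (auto simp: wf_edges_def single_vertex_def)
  next
    case False
    then show ?thesis
      using 1 by (subst Tree.simps) (auto intro!: bracket_edges(1))
  qed
qed

lemma num_verts_Tree:
  fixes n :: nat
  assumes "n \<ge> 1" "\<And>k. k \<in> {1..n} \<Longrightarrow> G n k \<le> n"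
  shows "num_verts (Tree G (int n)) = Suc n + (\<Sum>k\<in>{1..n}. num_verts (Tree G (int (G n k) - 1)))"
proof -
  define Ts where "Ts = map (\<lambda>j. Tree G (min (int (G n (nat (int n + 1 - j))) - 1) (int n - 1))) [1..int n]"
  have len: "length Ts = n"
    by (simp add: Ts_def)
  have T: "Tree G (int n) = Some (bracket Ts)"
    using assms(1) by (subst Tree.simps) (simp add: Ts_def)
  have nth: "Ts ! (j - 1) = Tree G (int (G n (n + 1 - j)) - 1)" if "j \<in> {1..n}" for j
  proof -
    have "Ts ! (j - 1) = Tree G (min (int (G n (nat (int n + 1 - int j))) - 1) (int n - 1))"
    proof -
      have "[1..int n] ! (j - 1) = int j"
        using that by (subst nth_upto) auto
      moreover have "j - 1 < length [1..int n]"
        using that by auto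
      ultimately show ?thesis by (simp add: Ts_def)
    qed
    also have "nat (int n + 1 - int j) = n + 1 - j"
      using that by auto
    finally have "Ts ! (j - 1) = Tree G (min (int (G n (n + 1 - j)) - 1) (int n - 1))" .
    moreover have "G n (n + 1 - j) \<le> n"
      using that by (intro assms(2)) auto
    ultimately show ?thesis by (simp add: min_absorb1)
  qed
  have "(\<Sum>j\<in>{1..n}. num_verts (Ts ! (j - 1)))
      = (\<Sum>j\<in>{1..n}. num_verts (Tree G (int (G n (n + 1 - j)) - 1)))"
    by (intro sum.cong refl) (simp only: nth)
  \<comment> \<open>The spine reads \<open>G n\<close> from \<open>n\<close> down to 1; reversing
    the sum undoes this.\<close>
  also have "\<dots> = (\<Sum>k\<in>{1..n}. num_verts (Tree G (int (G n k) - 1)))"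
    by (subst sum.atLeastAtMost_rev) (intro sum.cong, auto)
  moreover have "num_verts (Tree G (int n)) = Suc (card (edges (bracket Ts)))"
    by (simp add: T num_verts_def)
  ultimately show ?thesis
    by (subst (asm) bracket_edges(2)) (auto simp: Ts_def wf_edges_Tree len)
qed

lemma num_verts_eq_Suc_num_edges: "n \<ge> 0 \<Longrightarrow> num_verts (Tree G n) = Suc (num_edges (Tree G n))"
  by (subst (1 2) Tree.simps) (simp add: num_verts_def num_edges_def)

subsection \<open>The sequence of functions\<close>

definition pow2_part :: "nat \<Rightarrow> nat" where
  "pow2_part k = 2 ^ multiplicity 2 k"

definition dyadic :: "nat \<Rightarrow> nat" where
  "dyadic k = min (2 * pow2_part k - 1) ((3 * k - 1) div 4)"

text \<open>The restriction matches the extensional function space in \<open>F_funs\<close>; the cap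
  enforces the range condition.\<close>

definition dyadic_seq :: "nat \<Rightarrow> nat \<Rightarrow> nat" where
  "dyadic_seq n = (\<lambda>k\<in>{1..n}. min (dyadic k) (n div 2))"

text \<open>Since \<open>k\<close> is not divisible by \<open>2 ^ L\<close>, adding
  \<open>2 ^ L\<close> keeps its 2-adic valuation. Thus the upper half of a dyadic block repeats the
  lower one.\<close>

lemma pow2_part_add:
  assumes "0 < k" "k < 2 ^ L"
  shows "pow2_part (2 ^ L + k) = pow2_part k"
proof -
  have "multiplicity 2 k < L"
  proof (rule multiplicity_lessI)
    show "\<not> 2 ^ L dvd k"
      using assms by (auto dest: dvd_imp_le)
  qed (use assms in auto)
  then have "multiplicity 2 (k + 2 ^ L) = multiplicity (2::nat) k"
    by (intro multiplicity_sum_lt) (use assms in auto)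
  then show ?thesis
    by (simp add: pow2_part_def add.commute)
qed

lemma pow2_part_power: "pow2_part (2 ^ L) = 2 ^ L"
  by (simp add: pow2_part_def)

lemma pow2_part_3_power: "pow2_part (3 * 2 ^ L) = 2 ^ L"
proof -
  have "multiplicity (2::nat) (3 * 2 ^ L) = multiplicity 2 (3::nat) + multiplicity 2 (2 ^ L :: nat)"
    by (intro prime_elem_multiplicity_mult_distrib) auto
  also have "multiplicity 2 (3::nat) = 0"
    by (rule not_dvd_imp_multiplicity_0) simp
  finally show ?thesis
    by (simp add: pow2_part_def)
qed

lemma power_le_pow2_part: "2 ^ j dvd k \<Longrightarrow> k > 0 \<Longrightarrow> 2 ^ j \<le> pow2_part k"
  by (simp add: pow2_part_def multiplicity_geI)

text \<open>
  With $2^j \le i < 2^{j+1}$, the largest multiple of $2^j$ that is at most $n$ lies in the window;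
  it is at least $3 \cdot 2^j$ once $2i \ge 3 \cdot 2^j$.
\<close>

lemma dyadic_window:
  assumes "1 \<le> i" "2 * i \<le> n"
  shows "\<exists>k\<in>{n - i + 1..n}. dyadic k \<ge> i"
proof -
  obtain j where j: "2 ^ j \<le> i" "i < 2 * 2 ^ j"
    using ex_power_ivl1[of 2 i] assms by auto
  define q :: nat where "q = 2 ^ j"
  define a where "a = n div q"
  have q: "q > 0" "q \<le> i" "i < 2 * q"
    using j by (auto simp: q_def)
  have n: "a * q \<le> n" "n < a * q + q"
    using dividend_less_div_times[of q n] q by (auto simp: a_def)
  have "a \<ge> 2"
  proof (rule ccontr)
    assume "\<not> a \<ge> 2"
    then have "a * q \<le> 1 * q" by (intro mult_right_mono) auto
    then show False using n q assms by linarith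
  qed
  \<comment> \<open>This is where the factor 3/4 comes from. If \<open>a = 2\<close>, then
    \<open>2 * i < 3 * q\<close>, hence \<open>4 * i + 2 \<le> 6 * q\<close>; if
    \<open>a \<ge> 3\<close>, already \<open>4 * i < 8 * q\<close> suffices.\<close>
  have "4 * i + 1 \<le> 3 * (a * q)"
  proof (cases "a = 2")
    case True
    then show ?thesis using n q assms by simp
  next
    case False
    then have "3 * q \<le> a * q" using \<open>a \<ge> 2\<close> by (intro mult_right_mono) auto
    then show ?thesis using q by linarith
  qed
  moreover have "q \<le> pow2_part (a * q)"
    using q \<open>a \<ge> 2\<close> unfolding q_def by (intro power_le_pow2_part) auto
  ultimately have "dyadic (a * q) \<ge> i"
    using q by (auto simp: dyadic_def)
  then show ?thesis
    using n q assms by (intro bexI[of _ "a * q"]) auto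
qed

lemma dyadic_seq_in_F_funs: "dyadic_seq p \<in> F_funs p"
proof -
  have "\<exists>k\<in>{n - i + 1..n}. dyadic_seq p k \<ge> i" if n: "n \<in> {1..p}" and i: "i \<in> {1..n div 2}" for n i
  proof -
    obtain k where "k \<in> {n - i + 1..n}" "dyadic k \<ge> i"
      using dyadic_window[of i n] i by (metis atLeastAtMost_iff less_eq_div_iff_mult_less_eq mult.commute pos2)
    \<comment> \<open>The cap respects the window, as
      \<open>i \<le> n div 2 \<le> p div 2\<close>.\<close>
    then show ?thesis
      using n i by (intro bexI[of _ k]) (auto simp: dyadic_seq_def)
  qed
  then show ?thesis
    by (auto simp: F_funs_def dyadic_seq_def)
qed

subsection \<open>The recursion for the sizes\<close>

text \<open>The index is shifted by one, so that an entry $T_{g-1}$ contributes \<open>size_at g\<close>.\<close>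

definition size_at :: "nat \<Rightarrow> nat" where
  "size_at g = num_verts (Tree dyadic_seq (int g - 1))"

lemma size_at_0: "size_at 0 = 0"
  by (simp add: size_at_def num_verts_def Tree.simps)

lemma size_at_Suc:
  "size_at (Suc n) = Suc n + (\<Sum>k\<in>{1..n}. size_at (min (dyadic k) (n div 2)))"
proof (cases "n = 0")
  case True
  then show ?thesis
    by (simp add: size_at_def num_verts_def Tree.simps single_vertex_def)
next
  case False
  then have "size_at (Suc n) = Suc n + (\<Sum>k\<in>{1..n}. size_at (dyadic_seq n k))"
    using num_verts_Tree[of n dyadic_seq] by (auto simp: size_at_def dyadic_seq_def)
  also have "(\<Sum>k\<in>{1..n}. size_at (dyadic_seq n k)) = (\<Sum>k\<in>{1..n}. size_at (min (dyadic k) (n div 2)))"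
    by (intro sum.cong) (auto simp: dyadic_seq_def)
  finally show ?thesis .
qed

lemma size_at_mono: "m \<le> n \<Longrightarrow> size_at m \<le> size_at n"
proof (induction n arbitrary: m rule: less_induct)
  case (less n)
  show ?case
  proof (cases m)
    case 0
    then show ?thesis by (simp add: size_at_0)
  next
    case (Suc m')
    then obtain n' where n: "n = Suc n'" "m' \<le> n'"
      using less.prems by (cases n) auto
    have "(\<Sum>k\<in>{1..m'}. size_at (min (dyadic k) (m' div 2)))
        \<le> (\<Sum>k\<in>{1..m'}. size_at (min (dyadic k) (n' div 2)))"
      using n by (intro sum_mono less.IH) (auto intro: min.coboundedI2 simp: div_le_mono min.coboundedI1)
    also have "\<dots> \<le> (\<Sum>k\<in>{1..n'}. size_at (min (dyadic k) (n' div 2)))"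
      using n by (intro sum_mono2) auto
    finally show ?thesis
      using n by (simp add: Suc size_at_Suc)
  qed
qed

section \<open>Sums over dyadic blocks\<close>

abbreviation dsize :: "nat \<Rightarrow> nat" where
  "dsize L \<equiv> size_at (2 ^ L - 1)"

definition dyadic_sum :: "nat \<Rightarrow> nat" where
  "dyadic_sum L = (\<Sum>k\<in>{0<..<2 ^ L}. size_at (dyadic k))"

text \<open>Without the second bound of \<open>dyadic\<close> the sum is exactly self-similar and
  obeys a linear recursion.\<close>

definition pow2_sum :: "nat \<Rightarrow> nat" where
  "pow2_sum L = (\<Sum>k\<in>{0<..<2 ^ L}. size_at (2 * pow2_part k - 1))"

lemma sum_double_power:
  fixes f :: "nat \<Rightarrow> nat"
  shows "(\<Sum>k\<in>{0<..<2 ^ Suc L}. f k) = (\<Sum>k\<in>{0<..<2 ^ L}. f k) + f (2 ^ L) + (\<Sum>k\<in>{0<..<2 ^ L}. f (2 ^ L + k))"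
proof -
  have "(\<lambda>k. 2 ^ L + k) ` {0<..<2 ^ L} = {2 ^ L<..<2 ^ Suc L::nat}"
  proof (intro equalityI subsetI)
    fix x :: nat assume "x \<in> {2 ^ L<..<2 ^ Suc L}"
    then show "x \<in> (\<lambda>k. 2 ^ L + k) ` {0<..<2 ^ L}"
      by (intro image_eqI[of _ _ "x - 2 ^ L"]) auto
  qed auto
  then have "(\<Sum>k\<in>{0<..<2 ^ L}. f (2 ^ L + k)) = (\<Sum>k\<in>{2 ^ L<..<2 ^ Suc L}. f k)"
    by (intro sum.reindex_cong[symmetric, where l = "\<lambda>k. 2 ^ L + k"]) auto
  moreover have "{0<..<2 ^ Suc L::nat} = insert (2 ^ L) ({0<..<2 ^ L} \<union> {2 ^ L<..<2 ^ Suc L})"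
    by auto
  moreover have "sum f (insert (2 ^ L) ({0<..<2 ^ L} \<union> {2 ^ L<..<2 ^ Suc L}))
      = f (2 ^ L) + (sum f {0<..<2 ^ L} + sum f {2 ^ L<..<2 ^ Suc L})"
    by (subst sum.insert) (auto simp: sum.union_disjoint)
  ultimately show ?thesis by simp
qed

lemma pow2_sum_Suc: "pow2_sum (Suc L) = 2 * pow2_sum L + dsize (Suc L)"
  unfolding pow2_sum_def sum_double_power by (simp add: pow2_part_power pow2_part_add)

text \<open>There is no power of two strictly between \<open>2 ^ L\<close> and
  \<open>2 ^ Suc L\<close>, so passing to \<open>pow2_sum\<close> there loses nothing; only the
  midpoint keeps its lowered value.\<close>

lemma dyadic_sum_Suc: "dyadic_sum (Suc L) \<le> dyadic_sum L + pow2_sum L + size_at (dyadic (2 ^ L))"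
proof -
  have "(\<Sum>k\<in>{0<..<2 ^ L}. size_at (dyadic (2 ^ L + k))) \<le> pow2_sum L"
    unfolding pow2_sum_def by (intro sum_mono size_at_mono) (simp add: dyadic_def pow2_part_add)
  then show ?thesis
    unfolding dyadic_sum_def sum_double_power by simp
qed

text \<open>
  The point $3 \cdot 2^{v-2}$, which carries the value $2^{v-1} - 1$, occurs on the spine of
  $T_{2^v - 2}$ but not on that of $T_{3 \cdot 2^{v-2} - 2}$.
\<close>

lemma size_at_dyadic_power: "size_at (dyadic (2 ^ Suc v)) + dsize v \<le> dsize (Suc v)"
proof (cases v)
  case 0
  then show ?thesis
    using pow2_part_power[of 1] by (simp add: dyadic_def size_at_0)
next
  case (Suc w)
  show ?thesis
  \<comment> \<open>For \<open>v = 1\<close> the point 3 would lie beyond the spine, which has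
    length 2, so this case is computed directly.\<close>
  proof (cases w)
    case 0
    have "dyadic 1 = 0" "dyadic 2 = 1" "dyadic 4 = 2"
      using pow2_part_power[of 0] pow2_part_power[of 1] pow2_part_power[of 2]
      by (auto simp: dyadic_def)
    then show ?thesis
      using 0 Suc size_at_Suc[of 0] size_at_Suc[of 1] size_at_Suc[of 2]
      by (simp add: size_at_0 numeral_eq_Suc)
  next
    case w: (Suc z)
    define q :: nat where "q = 2 ^ w"
    have q: "q \<ge> 2" by (simp add: q_def w)
    have d: "dyadic (2 ^ Suc v) = 3 * q - 1"
      unfolding dyadic_def pow2_part_power using q by (simp add: Suc q_def)
    have d3: "dyadic (3 * q) = 2 * q - 1"
      unfolding dyadic_def q_def pow2_part_3_power using q by (simp add: q_def)
    have a: "size_at (3 * q - 1) = 3 * q - 1 + (\<Sum>k\<in>{1..3 * q - 2}. size_at (min (dyadic k) ((3 * q - 2) div 2)))"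
    proof -
      have "Suc (3 * q - 2) = 3 * q - 1" using q by simp
      then show ?thesis using size_at_Suc[of "3 * q - 2"] by simp
    qed
    have b: "(\<Sum>k\<in>{1..3 * q - 2}. size_at (min (dyadic k) ((3 * q - 2) div 2)))
        \<le> (\<Sum>k\<in>{1..3 * q - 2}. size_at (min (dyadic k) ((4 * q - 2) div 2)))"
      by (intro sum_mono size_at_mono min.mono div_le_mono) auto
    have "min (dyadic (3 * q)) ((4 * q - 2) div 2) = 2 * q - 1"
      using q by (simp add: d3)
    moreover have "2 ^ v - 1 = 2 * q - 1"
      by (simp add: Suc q_def)
    ultimately have "size_at (3 * q - 1) + dsize v
      \<le> 4 * q - 1 + (size_at (min (dyadic (3 * q)) ((4 * q - 2) div 2))
          + (\<Sum>k\<in>{1..3 * q - 2}. size_at (min (dyadic k) ((4 * q - 2) div 2))))"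
      using a b q by (simp only:) linarith
    also have "\<dots> = 4 * q - 1 + (\<Sum>k\<in>insert (3 * q) {1..3 * q - 2}. size_at (min (dyadic k) ((4 * q - 2) div 2)))"
      using q by (subst sum.insert) auto
    also have "\<dots> \<le> 4 * q - 1 + (\<Sum>k\<in>{1..4 * q - 2}. size_at (min (dyadic k) ((4 * q - 2) div 2)))"
      using q by (intro add_left_mono sum_mono2) auto
    also have "\<dots> = size_at (Suc (4 * q - 2))"
      using q by (simp add: size_at_Suc)
    also have "Suc (4 * q - 2) = 2 ^ Suc v - 1"
      using q by (simp add: Suc q_def)
    finally show ?thesis by (simp only: d)
  qed
qed

lemma dyadic_sum_le: "dyadic_sum (Suc L) \<le> dsize L + (\<Sum>j\<le>L. pow2_sum j)"
proof (induction L)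
  case 0
  have "{0<..<2} = {1::nat}" by auto
  then have "dyadic_sum 1 = 0"
    by (simp add: dyadic_sum_def dyadic_def size_at_0)
  then show ?case by simp
next
  case (Suc L)
  then show ?case
    \<comment> \<open>Telescoping: the midpoint costs at most
      \<open>dsize (Suc L) - dsize L\<close>, which turns \<open>dsize L\<close> into
      \<open>dsize (Suc L)\<close>.\<close>
    using dyadic_sum_Suc[of "Suc L"] size_at_dyadic_power[of L] by simp
qed

text \<open>Without the caps, the spine sum is part of a full dyadic block. Strictness saves the 1
  that offsets the \<open>+ 1\<close> in the bound on the partial sums of
  \<open>pow2_sum\<close>.\<close>

lemma dsize_Suc: "dsize (Suc L) < 2 ^ Suc L + dsize L + (\<Sum>j\<le>L. pow2_sum j)"
proof -
  define n :: nat where "n = 2 ^ Suc L - 2"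
  have "(2::nat) \<le> 2 ^ Suc L" by simp
  then have n: "2 ^ Suc L - 1 = Suc n"
    unfolding n_def by linarith
  have "(\<Sum>k\<in>{1..n}. size_at (min (dyadic k) (n div 2))) \<le> (\<Sum>k\<in>{1..n}. size_at (dyadic k))"
    by (intro sum_mono size_at_mono) auto
  also have "\<dots> \<le> dyadic_sum (Suc L)"
    unfolding dyadic_sum_def by (intro sum_mono2) (auto simp: n_def)
  finally show ?thesis
    using dyadic_sum_le[of L] n by (simp add: size_at_Suc)
qed

text \<open>
  Here $39/10 = y$, while $39/38 = y / (2(y - 2))$ solves $2a + y/2 = ay$, and
  $195/551 = (39/38) / (y - 1)$ comes from summing the geometric series.
\<close>

lemma dsize_bound:
  shows "real (dsize L) \<le> (39/10) ^ L / 2"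
    and "real (\<Sum>j<L. pow2_sum j) \<le> 195/551 * (39/10) ^ L - 2 ^ L + 1"
    and "real (pow2_sum L) \<le> 39/38 * (39/10) ^ L - 2 ^ L"
proof (induction L)
  case 0
  { case 1 show ?case by (simp add: size_at_0)
  next case 2 show ?case by simp
  next case 3 show ?case by (simp add: pow2_sum_def atLeastSucLessThan_greaterThanLessThan[symmetric]) }
next
  case (Suc L)
  have S: "real (\<Sum>j<Suc L. pow2_sum j) \<le> 195/551 * (39/10) ^ Suc L - 2 ^ Suc L + 1"
    using Suc by simp
  have "real (dsize (Suc L)) \<le> real (2 ^ Suc L + dsize L + (\<Sum>j<Suc L. pow2_sum j) - 1)"
    using dsize_Suc[of L] unfolding lessThan_Suc_atMost by (intro of_nat_mono) simp
  also have "\<dots> = 2 ^ Suc L + real (dsize L) + real (\<Sum>j<Suc L. pow2_sum j) - 1"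
    by (subst of_nat_diff) (auto simp: Suc_le_eq intro: trans_less_add1)
  \<comment> \<open>The powers of two and the units cancel; what remains is
    \<open>1/2 + 195/551 * y \<le> y/2\<close> for \<open>y = 39/10\<close>.\<close>
  also have "\<dots> \<le> (39/10) ^ Suc L / 2"
  proof -
    have "(0::real) < (39/10) ^ L" by simp
    then show ?thesis using S Suc(1) by simp
  qed
  finally have D: "real (dsize (Suc L)) \<le> (39/10) ^ Suc L / 2" .
  { case 1 show ?case by (rule D)
  next case 2 show ?case by (rule S)
  next case 3
    have "real (pow2_sum (Suc L)) = 2 * real (pow2_sum L) + real (dsize (Suc L))"
      by (simp only: pow2_sum_Suc of_nat_add of_nat_mult of_nat_numeral)
    then show ?case using D Suc(3) by simp }
qed

section \<open>From powers of two to every index\<close>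

lemma num_edges_dyadic_seq:
  assumes "m \<ge> 1" "39/10 \<le> 2 powr c" "c \<le> 2"
  shows "real (num_edges (Tree dyadic_seq (int m))) < (2 * real m) powr c"
proof -
  have c: "c > 1"
  proof (rule ccontr)
    assume "\<not> c > 1"
    then have "2 powr c \<le> 2 powr (1::real)" by (intro powr_mono) auto
    then show False using assms by simp
  qed
  have E: "size_at (Suc m) = Suc (num_edges (Tree dyadic_seq (int m)))"
    by (simp add: size_at_def num_verts_eq_Suc_num_edges)
  show ?thesis
  \<comment> \<open>The estimate \<open>3 * 2 ^ L \<le> 4 * m\<close> below fails for
    \<open>m = 1\<close>, where \<open>L = 1\<close>, and is tight for \<open>m = 3\<close>.\<close>
  proof (cases "m = 1")
    case True
    have "dyadic 1 = 0"
      using pow2_part_power[of 0] by (simp add: dyadic_def)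
    then have "num_edges (Tree dyadic_seq (int m)) = 1"
      using E size_at_Suc[of 1] True by (simp add: size_at_0)
    then show ?thesis
      using True assms by simp
  next
    case False
    obtain L where L: "2 ^ L \<le> Suc m" "Suc m < 2 ^ Suc L"
      using ex_power_ivl1[of 2 "Suc m"] by auto
    have "3 * 2 ^ L \<le> 4 * m"
    proof (cases "L \<ge> 2")
      case True
      then have "2 ^ 2 \<le> (2::nat) ^ L" by (intro power_increasing) auto
      then show ?thesis using L by simp
    next
      case F: False
      then have "2 ^ L \<le> (2::nat) ^ 1" by (intro power_increasing) auto
      then show ?thesis using False assms(1) by simp
    qed
    then have m: "3/4 * 2 ^ Suc L \<le> 2 * real m"
      by (simp add: field_simps flip: of_nat_le_iff[where ?'a = real])
    have "real (num_edges (Tree dyadic_seq (int m))) < real (size_at (Suc m))"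
      by (simp add: E)
    also have "\<dots> \<le> real (dsize (Suc L))"
      using L by (intro of_nat_mono size_at_mono) simp
    also have "\<dots> \<le> 1/2 * (39/10) ^ Suc L"
      using dsize_bound(1)[of "Suc L"] by simp
    \<comment> \<open>The factor 1/2 pays for rounding \<open>m + 1\<close> up to a power of two:
      \<open>c \<le> 2\<close> gives \<open>(3/4) powr c \<ge> 9/16\<close>.\<close>
    also have "\<dots> \<le> (3/4) powr c * (2 powr c) ^ Suc L"
    proof (intro mult_mono power_mono)
      have "(3/4) powr 2 \<le> (3/4::real) powr c"
        using assms by (intro powr_mono') auto
      then show "1/2 \<le> (3/4::real) powr c" by (simp add: power2_eq_square)
    qed (use assms in auto)
    also have "(2 powr c) ^ Suc L = (2 ^ Suc L) powr c"
      by (simp add: powr_powr powr_realpow[symmetric] mult.commute del: power_Suc)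
    also have "(3/4) powr c * (2 ^ Suc L) powr c = (3/4 * 2 ^ Suc L) powr c"
      by (rule powr_mult[symmetric])
    also have "\<dots> \<le> (2 * real m) powr c"
      using m c by (intro powr_mono2) auto
    finally show ?thesis .
  qed
qed

subsection \<open>The exponent\<close>

lemma exponent_equation_iff:
  "exponent_equation c \<longleftrightarrow> (let x = 2 powr c in 1 / x + 1 / x\<^sup>2 + 1 / (x / 2 - 1) - 1 / (x - 1) = 1)"
proof -
  have "2 powr (2 * c) = (2 powr c)\<^sup>2"
    by (simp add: power2_eq_square flip: powr_add)
  then show ?thesis
    by (simp add: exponent_equation_def Let_def powr_diff)
qed

text \<open>This confines solutions to the side of the pole \<open>x = 2\<close> on which the
  left-hand side is monotone. For \<open>1 < x < 2\<close> the pole term is negative and the rest is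
  below \<open>2 - 1\<close>; at \<open>x = 2\<close> the convention \<open>1 / 0 = 0\<close> gives
  \<open>-1/4\<close>.\<close>

lemma exponent_equation_imp_gt_2:
  assumes "c > 0" "exponent_equation c"
  shows "2 powr c > (2::real)"
proof (rule ccontr)
  define x :: real where "x = 2 powr c"
  assume "\<not> 2 powr c > (2::real)"
  moreover have "x > 1" using assms by (simp add: x_def)
  ultimately have x: "1 < x" "x \<le> 2" by (auto simp: x_def)
  have eq: "1 / x + 1 / x\<^sup>2 + 1 / (x / 2 - 1) - 1 / (x - 1) = 1"
    using assms by (simp add: exponent_equation_iff x_def Let_def)
  show False
  proof (cases "x = 2")
    case True
    with eq show False by simp
  next
    case False
    then have "1 / (x / 2 - 1) \<le> 0" "1 / x < 1" "1 / x\<^sup>2 < 1" "1 / (x - 1) \<ge> 1"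
      using x by (auto simp: divide_simps)
    then show False using eq by linarith
  qed
qed

lemma exponent_function_strict_antimono:
  fixes x y :: real
  assumes "2 < x" "x < y"
  shows "1 / y + 1 / y\<^sup>2 + 1 / (y / 2 - 1) - 1 / (y - 1) < 1 / x + 1 / x\<^sup>2 + 1 / (x / 2 - 1) - 1 / (x - 1)"
proof -
  \<comment> \<open>The subtracted term makes \<open>- 1 / (z - 1)\<close> increase; merged with its
    neighbour it becomes a sum of positive decreasing terms.\<close>
  have eq: "1 / (z / 2 - 1) - 1 / (z - 1) = 1 / (z - 2) + 1 / ((z - 1) * (z - 2))" if "z > 2" for z :: real
    using that by (simp add: divide_simps)
  have "1 / y < 1 / x" "1 / (y - 2) < 1 / (x - 2)"
    using assms by (auto intro: divide_strict_left_mono)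
  moreover have "1 / y\<^sup>2 < 1 / x\<^sup>2"
    using assms by (intro divide_strict_left_mono power_strict_mono) auto
  moreover have "1 / ((y - 1) * (y - 2)) < 1 / ((x - 1) * (x - 2))"
    using assms by (intro divide_strict_left_mono mult_strict_mono) auto
  ultimately show ?thesis
    using eq[of x] eq[of y] assms by linarith
qed

lemma exponent_equation_unique:
  assumes "c > 0" "exponent_equation c" "d > 0" "exponent_equation d"
  shows "c = d"
proof -
  have "2 powr c = (2 powr d :: real)"
    using exponent_function_strict_antimono[of "2 powr c" "2 powr d"]
      exponent_function_strict_antimono[of "2 powr d" "2 powr c"]
      exponent_equation_imp_gt_2[of c] exponent_equation_imp_gt_2[of d] assms
    by (auto simp: exponent_equation_iff Let_def) (metis less_irrefl linorder_neqE)
  then show ?thesis by (simp add: powr_inj)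
qed

text \<open>The fractions $127/64$ and $131/66$ enclose $c$ and lie in the required interval.\<close>

lemma log2_lower:
  fixes x :: real
  assumes "3.957 \<le> x"
  shows "1.984 \<le> log 2 x"
proof -
  have "4 / x \<le> 1.01087"
    using assms by (simp add: field_simps)
  \<comment> \<open>1.4135 lies just below the square root of 2, so squaring yields
    \<open>(4 / x) ^ 64 \<le> 2\<close>, that is \<open>log 2 x \<ge> 127/64\<close>.\<close>
  then have "(4 / x) ^ 32 \<le> 1.01087 ^ 32"
    using assms by (intro power_mono) auto
  also have "\<dots> \<le> 1.4135" by (simp add: power_divide)
  finally have "((4 / x) ^ 32) ^ 2 \<le> 1.4135 ^ 2"
    using assms by (intro power_mono) auto
  then have "(4 / x) ^ 64 \<le> 2"
    unfolding power_mult[symmetric] by (simp add: power2_eq_square)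
  then have "log 2 ((4 / x) ^ 64) \<le> log 2 2"
    using assms by (subst log_le_cancel_iff) auto
  then have "64 * log 2 (4 / x) \<le> 1"
    using assms by (simp add: log_nat_power)
  moreover have "log 2 (4 / x) = 2 - log 2 x"
    using assms log_pow_cancel[of 2 2] by (simp add: log_divide)
  ultimately show ?thesis by simp
qed

lemma log2_upper:
  fixes x :: real
  assumes "0 < x" "x \<le> 3.958"
  shows "log 2 x < 1.985"
proof -
  have "1.01061 \<le> 4 / x"
    using assms by (simp add: field_simps)
  \<comment> \<open>Here 1.415 lies just above the square root of 2, which leads to
    \<open>log 2 x < 131/66\<close>.\<close>
  have "1.415 \<le> (1.01061::real) ^ 33" by (simp add: power_divide)
  also have "\<dots> \<le> (4 / x) ^ 33"
    using \<open>1.01061 \<le> 4 / x\<close> by (intro power_mono) auto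
  finally have "1.415 ^ 2 \<le> ((4 / x) ^ 33) ^ 2"
    by (intro power_mono) auto
  then have "2 < (4 / x) ^ 66"
    unfolding power_mult[symmetric] by (simp add: power2_eq_square)
  then have "log 2 2 < log 2 ((4 / x) ^ 66)"
    using assms by (subst log_less_cancel_iff) auto
  then have "1 < 66 * log 2 (4 / x)"
    using assms by (simp add: log_nat_power)
  moreover have "log 2 (4 / x) = 2 - log 2 x"
    using assms log_pow_cancel[of 2 2] by (simp add: log_divide)
  ultimately show ?thesis by simp
qed
lemma exponent_exists:
  obtains c :: real where "exponent_equation c" "1.984 \<le> c" "c < 1.985" "39/10 \<le> 2 powr c"
proof -
  \<comment> \<open>\<open>p x = 0\<close> is the equation for \<open>x = 2 powr c\<close>
    multiplied by \<open>x\<^sup>2 * (x - 1) * (x - 2)\<close>.\<close>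
  define p :: "real \<Rightarrow> real" where "p x = x ^ 4 - 5 * x ^ 3 + 4 * x ^ 2 + x - 2" for x
  have "\<exists>x. 3.957 \<le> x \<and> x \<le> 3.958 \<and> p x = 0"
    by (rule IVT') (auto simp: p_def power_divide intro!: continuous_intros)
  then obtain x where x: "3.957 \<le> x" "x \<le> 3.958" "p x = 0" by auto
  define c where "c = log 2 x"
  have xc: "2 powr c = x"
    using x by (simp add: c_def)
  \<comment> \<open>This is \<open>x * p x = 0\<close>, arranged to match the equation after
    clearing denominators.\<close>
  have "((x\<^sup>2 + x) * (x - 2) + 2 * (x * x\<^sup>2)) * (x - 1) - x * x\<^sup>2 * (x - 2) = x * x\<^sup>2 * (x - 2) * (x - 1)"
    using x(3) unfolding p_def by algebra
  then have "exponent_equation c"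
    unfolding exponent_equation_iff xc Let_def using x(1)
    by (simp add: divide_simps)
  moreover have "1.984 \<le> c" "c < 1.985"
    using x log2_lower[of x] log2_upper[of x] by (auto simp: c_def)
  moreover have "39/10 \<le> 2 powr c"
    using x by (simp add: xc)
  ultimately show ?thesis by (rule that)
qed

theorem theorem6:
  "\<exists>c::real. 0 < c \<and> exponent_equation c \<and>
     (\<forall>c'. 0 < c' \<and> exponent_equation c' \<longrightarrow> c' = c) \<and>
     1.984 \<le> c \<and> c < 1.985 \<and>
     (\<exists>G :: nat \<Rightarrow> nat \<Rightarrow> nat.
        (\<forall>i\<ge>1. G i \<in> F_funs i) \<and>
        (\<forall>m::nat. m \<ge> 1 \<longrightarrow>
           real (num_edges (Tree G (int m))) < (2 * real m) powr c))"
proof -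
  obtain c :: real where c: "exponent_equation c" "1.984 \<le> c" "c < 1.985" "39/10 \<le> 2 powr c"
    by (rule exponent_exists)
  have "\<forall>c'. 0 < c' \<and> exponent_equation c' \<longrightarrow> c' = c"
    using exponent_equation_unique[of _ c] c by auto
  moreover have "\<forall>i\<ge>1. dyadic_seq i \<in> F_funs i"
    by (simp add: dyadic_seq_in_F_funs)
  moreover have "\<forall>m::nat. m \<ge> 1 \<longrightarrow> real (num_edges (Tree dyadic_seq (int m))) < (2 * real m) powr c"
    using num_edges_dyadic_seq c by auto
  ultimately show ?thesis
    using c by (intro exI[of _ c]) (auto intro!: exI[of _ dyadic_seq])
qed

end
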